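(* Let $N = q^k n^2$ be an odd perfect number given in Eulerian form. Define $H = \gcd(n^2,\sigma(n^2))$, $I = \gcd(n,\sigma(n^2))$ and $J = H/I$. If $H$ is squarefree, then $J = 1$.
   Context: $\sigma(x)$ denotes the sum of the positive divisors of $x$. A positive integer $N$ is perfect if $\sigma(N)=2N$. An odd perfect number $N$ is said to be given in Eulerian form $N = q^k n^2$ if $q$ is a prime (the special prime), $k$ and $n$ are positive integers, $q \equiv k \equiv 1 \pmod 4$, and $\gcd(q,n)=1$. *)

theory Defs
  imports "HOL-Number_Theory.Number_Theory" "HOL-Computational_Algebra.Squarefree"
begin

text \<open>At \<open>x = 0\<close> the index set is infinite, so \<open>divisor_sum 0 = 0\<close>; only positive \<open>x\<close> matter.\<close>

definition divisor_sum :: "nat \<Rightarrow> nat" where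
  "divisor_sum x = (\<Sum>d | d dvd x. d)"

definition perfect :: "nat \<Rightarrow> bool" where
  "perfect N \<longleftrightarrow> N > 0 \<and> divisor_sum N = 2 * N"

definition eulerian_form :: "nat \<Rightarrow> nat \<Rightarrow> nat \<Rightarrow> nat \<Rightarrow> bool" where
  "eulerian_form N q k n \<longleftrightarrow>
     N = q ^ k * n\<^sup>2 \<and> prime q \<and> k > 0 \<and> n > 0 \<and>
     [q = k] (mod 4) \<and> [k = 1] (mod 4) \<and> gcd q n = 1"

text \<open>The next fact shows that the quotient \<open>H div I\<close> of the gcds
  \<open>H = gcd (n\<^sup>2) (divisor_sum (n\<^sup>2))\<close> and \<open>I = gcd n (divisor_sum (n\<^sup>2))\<close> is exact,
  so that truncated division on \<^typ>\<open>nat\<close> is the true quotient.\<close>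

lemma gcd_dvd_gcd_square: "gcd n s dvd gcd (n\<^sup>2) s" for n s :: nat
  by (simp add: power2_eq_square)

end

theory Submission
  imports Defs
begin

text \<open>A squarefree divisor of a power of \<open>n\<close> already divides \<open>n\<close>. So
  a squarefree \<open>H\<close>, being a divisor of \<open>n\<^sup>2\<close>, divides both
  \<open>n\<close> and \<open>divisor_sum (n\<^sup>2)\<close>, hence \<open>I\<close>. As
  \<open>I\<close> always divides \<open>H\<close>, the two agree.\<close>

text \<open>Prime factorisations need not exist in a \<open>semiring_gcd\<close>, so the argument
  uses gcds: the cofactor \<open>a'\<close> of \<open>gcd a b\<close> in \<open>a\<close> is coprime
  to \<open>b'\<close> and to \<open>gcd a b\<close>, yet divides a power of their product, so it is
  a unit.\<close>

lemma squarefree_dvd_power_imp_dvd: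
  fixes a b :: "'a :: semiring_gcd"
  assumes "squarefree a" and "a dvd b ^ n"
  shows "a dvd b"
proof -
  have "gcd a b \<noteq> 0"
    using assms(1) by auto
  then obtain a' b' where a: "a = a' * gcd a b" and b: "b = b' * gcd a b"
    and coprime: "coprime a' b'"
    using gcd_coprime_exists by blast
  have "a' dvd b' ^ n * gcd a b ^ n"
    using assms(2) a b by (metis dvd_mult_left power_mult_distrib)
  then have a'_dvd: "a' dvd gcd a b ^ n"
    using coprime by (simp add: coprime_dvd_mult_right_iff)
  \<comment> \<open>Squarefreeness enters here: a common divisor of the two factors of
    \<open>a\<close> has its square dividing \<open>a\<close>.\<close>
  have "coprime a' (gcd a b)"
  proof (rule coprimeI)
    fix c assume "c dvd a'" "c dvd gcd a b"
    then have "c\<^sup>2 dvd a"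
      by (metis a mult_dvd_mono power2_eq_square)
    then show "is_unit c"
      using assms(1) by (rule squarefreeD[rotated])
  qed
  then have "is_unit a'"
    using a'_dvd coprime_power_right_iff coprime_common_divisor[of a' "gcd a b ^ n" a']
    \<comment> \<open>For \<open>n = 0\<close>, \<open>a'_dvd\<close> itself says that
      \<open>a'\<close> divides 1.\<close>
    by (cases "n = 0") auto
  then have "a dvd gcd a b"
    using a by (metis dvd_refl mult_unit_dvd_iff')
  then show ?thesis
    by simp
qed

theorem theorem4:
  fixes N q k n H I J :: nat
  assumes "odd N" and "perfect N" and "eulerian_form N q k n"
    and "H = gcd (n\<^sup>2) (divisor_sum (n\<^sup>2))"
    and "I = gcd n (divisor_sum (n\<^sup>2))"
    and "J = H div I"
    and "squarefree H"
  shows "J = 1"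
proof -
  have "H dvd n"
    using assms(4,7) squarefree_dvd_power_imp_dvd by (metis gcd_dvd1)
  then have "H dvd I"
    using assms(4,5) by simp
  moreover have "I dvd H"
    using assms(4,5) gcd_dvd_gcd_square by simp
  ultimately have "H = I"
    by (rule dvd_antisym)
  \<comment> \<open>Excludes \<open>0 div 0\<close>, which is 0 rather than 1.\<close>
  moreover have "H \<noteq> 0"
    using assms(7) not_squarefree_0 by metis
  ultimately show ?thesis
    using assms(6) by simp
qed

end
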